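(* Let $X\in\mathcal C$ be an irreducible quadruple and $F$ a flippable irreducible flat of $X$, with unique traversing position $t_F$. Any folded position $i\in I_X\cap F$ gives a $1$-flip of $I_X$ along $\{i\}$ of the form $I_X\overset{\sigma_{\{i\},\{t_F\}}}{\longrightarrow}I(i)$, where $I(i)=(I_X\setminus\{i\})\cup\{t_F\}$, which gives an object $\theta_{F,i}(X)=(W_X,Q_X,\pi_X,I(i))\in\mathcal C$. Conversely, any $1$-flip of $I_X$ is of this form.
   Context: Quadruples. For a Coxeter group $W$ of finite rank with simple reflections $s_1,\dots,s_n$, let $V$ be the real vector space with basis the simple roots $\alpha_1,\dots,\alpha_n$, with the form $\langle\alpha_i,\alpha_j\rangle=-\cos(\pi/\operatorname{ord}(s_is_j))$, the usual geometric action of $W$, and root system $\Phi=\Phi^+\sqcup\Phi^-$. Write $[m]=\{1,\dots,m\}$. For a word $Q=s_{i_1}\cdots s_{i_m}$ and $\pi\in W$, the subword complex $\mathcal{SC}_W(Q,\pi)$ is the simplicial complex whose faces are the subsets $I\subseteq[m]$ such that the subword of $Q$ at positions $[m]\setminus I$ contains a reduced expression of $\pi$. A quadruple is $X=(W_X,Q_X,\pi_X,I_X)$ with $I_X$ a maximal face of $\mathcal{SC}_{W_X}(Q_X,\pi_X)$; $n_X$ is the length of $Q_X$, and $V_X,\Phi_X$ are the vector space and root system of $W_X$. The root function is $r_X(l)=\big(\prod_{j\in[l-1]\setminus I_X}s_{i_j}\big)(\alpha_{i_l})$ for $l\in[n_X]$ (product in increasing order of $j$). For $H\subseteq[n_X]$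 let $\mathrm V(H)=\operatorname{span}\{r_X(i):i\in H\}$. $X$ is irreducible if $V_X=\mathrm V(I_X)$; $\mathcal C$ is the collection of irreducible quadruples. Flats. For a subspace $V\subseteq V_X$, the flat associated with $V$ is $\mathrm F(V)=\{i\in[n_X]: r_X(i)\in V\}$. A flat $F$ induces a quadruple $X_F$ whose root system is $\Phi_X\cap\mathrm V(F)$ and with $V_{X_F}=\mathrm V(F)$; $\deg X_F$ is the rank of its Coxeter group. $F$ is irreducible if $\mathrm V(F)=\mathrm V(F\cap I_X)$. Positions and flips. Elements of $I_X$ are folded positions; elements of $[n_X]\setminus I_X$ are traversing positions. An irreducible flat $F$ is flippable if $\deg X_F=1$ and $F$ contains a traversing position; this traversing position is then unique and denoted $t_F$, so $F=\{t_F\}\cup(I_X\cap F)$. A maximal face $I'$ of $\mathcal{SC}_W(Q,\pi)$ is obtained from another maximal face $I$ by a flip $\sigma_{L,L'}$ along a subset $L\subseteq I$ if there is $L'\subseteq I'$ with $I\setminus L=I'\setminus L'$. The degree of the flip $\sigma_{L,L'}$ is $|L|$, and a $1$-flip is a flip of degree $1$. *)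

theory Defs
  imports
    "HOL-Analysis.Analysis"
    "HOL-Algebra.Multiplicative_Group"
    "HOL-Algebra.Generated_Groups"
    "HOL-Library.Sublist"
begin

section \<open>Coxeter systems\<close>

text \<open>
  The simple reflections are indexed by a finite type \<open>'n\<close>, whose cardinality is the rank.
  A word in the simple reflections is the list of its indices.
\<close>

definition word_prod :: "('g, 'b) monoid_scheme \<Rightarrow> ('n \<Rightarrow> 'g) \<Rightarrow> 'n list \<Rightarrow> 'g" where
  "word_prod G s u = foldr (\<lambda>i g. s i \<otimes>\<^bsub>G\<^esub> g) u \<one>\<^bsub>G\<^esub>"

text \<open>
  The congruence on words generated by the relations \<open>(s\<^sub>i s\<^sub>j)^(m i j) = 1\<close>.  The value
  \<open>m i j = 0\<close> encodes an infinite order: the relation is then trivial.  With \<open>m i i = 1\<close> the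
  generators are involutions, so that the quotient of the free monoid by this congruence is
  the group with generators \<open>s\<^sub>i\<close> and these relations.
\<close>

inductive cox_rel :: "('n \<Rightarrow> 'n \<Rightarrow> nat) \<Rightarrow> 'n list \<Rightarrow> 'n list \<Rightarrow> bool"
  for m :: "'n \<Rightarrow> 'n \<Rightarrow> nat" where
  relator: "cox_rel m (u @ concat (replicate (m i j) [i, j]) @ v) (u @ v)"
| reflexive: "cox_rel m u u"
| symmetric: "cox_rel m u v \<Longrightarrow> cox_rel m v u"
| transitive: "cox_rel m u v \<Longrightarrow> cox_rel m v w \<Longrightarrow> cox_rel m u w"

text \<open>\<^const>\<open>group.ord\<close> is \<open>0\<close> at elements of infinite order.\<close>

definition cox_ord :: "('g, 'b) monoid_scheme \<Rightarrow> ('n \<Rightarrow> 'g) \<Rightarrow> 'n \<Rightarrow> 'n \<Rightarrow> nat" where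
  "cox_ord G s i j = group.ord G (s i \<otimes>\<^bsub>G\<^esub> s j)"

definition coxeter_system :: "('g, 'b) monoid_scheme \<Rightarrow> ('n::finite \<Rightarrow> 'g) \<Rightarrow> bool" where
  "coxeter_system G s \<longleftrightarrow>
     group G \<and> inj s \<and> range s \<subseteq> carrier G \<and> (\<forall>i. group.ord G (s i) = 2) \<and>
     generate G (range s) = carrier G \<and>
     (\<forall>u v. word_prod G s u = word_prod G s v \<longleftrightarrow> cox_rel (cox_ord G s) u v)"

definition reduced_expression ::
  "('g, 'b) monoid_scheme \<Rightarrow> ('n \<Rightarrow> 'g) \<Rightarrow> 'n list \<Rightarrow> 'g \<Rightarrow> bool" where
  "reduced_expression G s u g \<longleftrightarrow>
     word_prod G s u = g \<and> (\<forall>v. word_prod G s v = g \<longrightarrow> length u \<le> length v)"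


section \<open>Geometric representation and root system\<close>

abbreviation simple_root :: "'n \<Rightarrow> real ^ 'n" where
  "simple_root i \<equiv> axis i 1"

text \<open>
  If \<open>s\<^sub>i s\<^sub>j\<close> has infinite order, then \<open>pi / 0 = 0\<close> yields the customary coefficient
  \<open>-1 = - cos (pi / \<infinity>)\<close>.
\<close>

definition cox_form ::
  "('g, 'b) monoid_scheme \<Rightarrow> ('n::finite \<Rightarrow> 'g) \<Rightarrow> real ^ 'n \<Rightarrow> real ^ 'n \<Rightarrow> real" where
  "cox_form G s v w =
     (\<Sum>i\<in>UNIV. \<Sum>j\<in>UNIV. v $ i * w $ j * (- cos (pi / real (cox_ord G s i j))))"

definition simple_reflection ::
  "('g, 'b) monoid_scheme \<Rightarrow> ('n::finite \<Rightarrow> 'g) \<Rightarrow> 'n \<Rightarrow> real ^ 'n \<Rightarrow> real ^ 'n" where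
  "simple_reflection G s i v = v - (2 * cox_form G s (simple_root i) v) *\<^sub>R simple_root i"

definition word_act ::
  "('g, 'b) monoid_scheme \<Rightarrow> ('n::finite \<Rightarrow> 'g) \<Rightarrow> 'n list \<Rightarrow> real ^ 'n \<Rightarrow> real ^ 'n" where
  "word_act G s u v = foldr (simple_reflection G s) u v"

text \<open>
  The action of a group element is computed from any word representing it; it does not depend
  on that word, see \<open>geom_act_word_prod\<close> below.
\<close>

definition geom_act ::
  "('g, 'b) monoid_scheme \<Rightarrow> ('n::finite \<Rightarrow> 'g) \<Rightarrow> 'g \<Rightarrow> real ^ 'n \<Rightarrow> real ^ 'n" where
  "geom_act G s g = word_act G s (SOME u. word_prod G s u = g)"

definition roots :: "('g, 'b) monoid_scheme \<Rightarrow> ('n::finite \<Rightarrow> 'g) \<Rightarrow> (real ^ 'n) set" where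
  "roots G s = {geom_act G s g (simple_root i) | g i. g \<in> carrier G}"

definition positive_roots ::
  "('g, 'b) monoid_scheme \<Rightarrow> ('n::finite \<Rightarrow> 'g) \<Rightarrow> (real ^ 'n) set" where
  "positive_roots G s = {\<beta> \<in> roots G s. \<forall>i. 0 \<le> \<beta> $ i}"

lemma cox_form_add_right: "cox_form G s u (v + w) = cox_form G s u v + cox_form G s u w"
  by (simp add: cox_form_def algebra_simps sum.distrib sum_subtractf sum_negf)

lemma cox_form_scale_right: "cox_form G s u (c *\<^sub>R w) = c * cox_form G s u w"
  by (simp add: cox_form_def sum_distrib_left mult_ac sum_negf)

lemma cox_form_simple:
  "cox_form G s (simple_root i) (simple_root j) = - cos (pi / real (cox_ord G s i j))"
proof -
  have "cox_form G s (simple_root i) (simple_root j) =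
      (\<Sum>k\<in>UNIV. \<Sum>l\<in>UNIV. if l = j then (if k = i then - cos (pi / real (cox_ord G s k l)) else 0) else 0)"
    unfolding cox_form_def by (intro sum.cong refl) (auto simp: axis_def)
  then show ?thesis by simp
qed

lemma cox_ord_self:
  assumes "coxeter_system G s"
  shows "s i \<otimes>\<^bsub>G\<^esub> s i = \<one>\<^bsub>G\<^esub>" "cox_ord G s i i = 1"
proof -
  interpret group G using assms by (simp add: coxeter_system_def)
  have c: "s i \<in> carrier G" and o: "ord (s i) = 2" using assms by (auto simp: coxeter_system_def)
  have "s i [^]\<^bsub>G\<^esub> (2::nat) = \<one>\<^bsub>G\<^esub>" using pow_ord_eq_1[OF c] o by simp
  then show "s i \<otimes>\<^bsub>G\<^esub> s i = \<one>\<^bsub>G\<^esub>" using c by (simp add: numeral_2_eq_2)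
  then show "cox_ord G s i i = 1" by (simp add: cox_ord_def)
qed

lemma cox_ord_commute:
  assumes "coxeter_system G s"
  shows "cox_ord G s i j = cox_ord G s j i"
proof -
  interpret group G using assms by (simp add: coxeter_system_def)
  have c: "s k \<in> carrier G" for k using assms by (auto simp: coxeter_system_def)
  have "inv\<^bsub>G\<^esub> (s k) = s k" for k using cox_ord_self(1)[OF assms, of k] c by (simp add: inv_equality)
  then have "s i \<otimes>\<^bsub>G\<^esub> s j = inv\<^bsub>G\<^esub> (s j \<otimes>\<^bsub>G\<^esub> s i)" using c by (simp add: inv_mult_group)
  then show ?thesis using c by (simp add: cox_ord_def ord_inv)
qed

lemma cox_ord_neq_1:
  assumes "coxeter_system G s" "i \<noteq> j"
  shows "cox_ord G s i j \<noteq> 1"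
proof
  interpret group G using assms by (simp add: coxeter_system_def)
  have c: "s k \<in> carrier G" for k using assms by (auto simp: coxeter_system_def)
  assume "cox_ord G s i j = 1"
  then have "s i \<otimes>\<^bsub>G\<^esub> s j = \<one>\<^bsub>G\<^esub>" using c pow_ord_eq_1[of "s i \<otimes>\<^bsub>G\<^esub> s j"]
    by (simp add: cox_ord_def)
  then have "s i \<otimes>\<^bsub>G\<^esub> s j = s j \<otimes>\<^bsub>G\<^esub> s j" using cox_ord_self(1)[OF assms(1)] by simp
  then have "s i = s j" using c by (simp add: right_cancel)
  then show False using assms by (auto simp: coxeter_system_def inj_def)
qed

lemma word_act_append: "word_act G s (u @ v) x = word_act G s u (word_act G s v x)"
  by (simp add: word_act_def)

lemma simple_reflection_involution:
  assumes "coxeter_system G s"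
  shows "simple_reflection G s i (simple_reflection G s i v) = v"
proof -
  have "cox_form G s (simple_root i) (simple_root i) = 1"
    using cox_ord_self(2)[OF assms] by (simp add: cox_form_simple)
  then have "cox_form G s (simple_root i) (simple_reflection G s i v) = - cox_form G s (simple_root i) v"
    using cox_form_add_right[of G s "simple_root i" v "(- 2 * cox_form G s (simple_root i) v) *\<^sub>R simple_root i"]
    by (simp only: simple_reflection_def cox_form_scale_right) simp
  then show ?thesis
    by (simp add: simple_reflection_def[of G s i "simple_reflection G s i v"])
       (simp add: simple_reflection_def)
qed

lemma word_act_relator:
  fixes s :: "'n::finite \<Rightarrow> 'g"
  assumes C: "coxeter_system G s"
  shows "word_act G s (concat (replicate (cox_ord G s i j) [i, j])) v = v"
proof (cases "i = j \<or> cox_ord G s i j = 0")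
  case True
  then show ?thesis
    using cox_ord_self(2)[OF C] simple_reflection_involution[OF C] by (auto simp: word_act_def)
next
  case False
  define m where "m = cox_ord G s i j"
  define \<theta> where "\<theta> = pi / real m"
  define c where "c = cos \<theta>"
  have m: "m \<ge> 2" using False cox_ord_neq_1[OF C, of i j] by (simp add: m_def)
  then have "0 < \<theta>" "\<theta> < pi" by (simp_all add: \<theta>_def divide_less_eq)
  then have s0: "sin \<theta> \<noteq> 0" using sin_gt_zero by force
  have m\<theta>: "real m * \<theta> = pi" using m by (simp add: \<theta>_def)
  let ?B = "cox_form G s" and ?e = "simple_root :: 'n \<Rightarrow> _"
  have Bii: "?B (?e k) (?e k) = 1" for k using cox_ord_self(2)[OF C] by (simp add: cox_form_simple)
  have Bij: "?B (?e i) (?e j) = - c" by (simp add: cox_form_simple c_def \<theta>_def m_def)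
  have Bji: "?B (?e j) (?e i) = - c"
    using cox_ord_commute[OF C, of j i] by (simp add: cox_form_simple c_def \<theta>_def m_def)
  define p q where "p = ?B (?e i) v" and "q = ?B (?e j) v"
  define x y where "x = - (p + c * q) / (sin \<theta>)\<^sup>2" and "y = - (q + c * p) / (sin \<theta>)\<^sup>2"
  have s2: "(sin \<theta>)\<^sup>2 = 1 - c\<^sup>2" by (simp add: c_def sin_squared_eq)
  have d0: "1 - c\<^sup>2 \<noteq> 0" using s0 s2 by force
  have fy: "y = c * x - q" and fx: "x = c * y - p"
    using d0 unfolding x_def y_def s2 by (simp_all add: field_simps power2_eq_square)
  define a where "a t = (- x * sin (t * \<theta>) + y * sin ((t - 1) * \<theta>)) / sin \<theta>" for t :: real
  have rec: "a (t + 2) = 2 * c * a (t + 1) - a t" for t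
  proof -
    have e: "sin ((r + 1) * \<theta>) = 2 * c * sin (r * \<theta>) - sin ((r - 1) * \<theta>)" for r
      by (simp add: c_def algebra_simps sin_add sin_diff)
    have e1: "sin ((t + 2) * \<theta>) = 2 * c * sin ((t + 1) * \<theta>) - sin (t * \<theta>)"
      using e[of "t + 1"] by (simp add: add.commute add.left_commute)
    have e2: "sin ((t + 1) * \<theta>) = 2 * c * sin (t * \<theta>) - sin ((t - 1) * \<theta>)"
      by (rule e)
    have e3: "a (t + 2) = (- x * sin ((t + 2) * \<theta>) + y * sin ((t + 1) * \<theta>)) / sin \<theta>"
      by (simp add: a_def algebra_simps)
    have e4: "a (t + 1) = (- x * sin ((t + 1) * \<theta>) + y * sin (t * \<theta>)) / sin \<theta>"
      by (simp add: a_def)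
    have n: "- x * sin ((t + 2) * \<theta>) + y * sin ((t + 1) * \<theta>)
        = 2 * c * (- x * sin ((t + 1) * \<theta>) + y * sin (t * \<theta>))
          - (- x * sin (t * \<theta>) + y * sin ((t - 1) * \<theta>))"
    proof -
      have "- x * S2 + y * S1 = 2 * c * (- x * S1 + y * S0) - (- x * S0 + y * S)"
        if S2: "S2 = 2 * c * S1 - S0" and S1: "S1 = 2 * c * S0 - S" for S S0 S1 S2
      proof -
        have S: "S = 2 * c * S0 - S1" using S1 by simp
        show ?thesis unfolding S S2 by (simp add: algebra_simps)
      qed
      then show ?thesis using e1 e2 .
    qed
    show ?thesis unfolding e3 e4 n by (simp only: a_def diff_divide_distrib times_divide_eq_right)
  qed
  have step: "simple_reflection G s i (simple_reflection G s j (v + r *\<^sub>R ?e i + t *\<^sub>R ?e j))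
      = v + r' *\<^sub>R ?e i + t' *\<^sub>R ?e j"
    if "t' = - t - 2 * q + 2 * c * r" "r' = - r - 2 * p + 2 * c * t'" for r t r' t'
  proof -
    have 1: "?B (?e j) (v + r *\<^sub>R ?e i + t *\<^sub>R ?e j) = q - c * r + t"
      by (simp add: cox_form_add_right cox_form_scale_right Bii Bji q_def)
    have 2: "t' = t - 2 * (q - c * r + t)" using that(1) by (simp add: algebra_simps)
    have 3: "simple_reflection G s j (v + r *\<^sub>R ?e i + t *\<^sub>R ?e j) = v + r *\<^sub>R ?e i + t' *\<^sub>R ?e j"
      unfolding simple_reflection_def 1 2 by (simp only: scaleR_diff_left add_diff_eq)
    have 4: "?B (?e i) (v + r *\<^sub>R ?e i + t' *\<^sub>R ?e j) = p + r - c * t'"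
      by (simp add: cox_form_add_right cox_form_scale_right Bii Bij p_def)
    have 5: "r' = r - 2 * (p + r - c * t')" using that(2) by (simp add: algebra_simps)
    show ?thesis
      unfolding 3 unfolding simple_reflection_def 4 5 by (simp only: scaleR_diff_left) simp
  qed
  have iter: "word_act G s (concat (replicate k [i, j])) v
      = v + (x + a (2 * real k + 1)) *\<^sub>R ?e i + (y + a (2 * real k)) *\<^sub>R ?e j" for k
  proof (induction k)
    case 0
    have "a 0 = - y" "a 1 = - x" using s0 by (simp_all add: a_def)
    then show ?case by (simp add: word_act_def)
  next
    case (Suc k)
    have "word_act G s (concat (replicate (Suc k) [i, j])) v =
      simple_reflection G s i (simple_reflection G s j (word_act G s (concat (replicate k [i, j])) v))"
      by (simp add: word_act_def)
    also have "\<dots> = v + (x + a (2 * real (Suc k) + 1)) *\<^sub>R ?e i + (y + a (2 * real (Suc k))) *\<^sub>R ?e j"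
      unfolding Suc
    proof (rule step)
      have r1: "a (2 * real (Suc k)) = 2 * c * a (2 * real k + 1) - a (2 * real k)"
        using rec[of "2 * real k"] by (simp add: algebra_simps)
      show "y + a (2 * real (Suc k)) = - (y + a (2 * real k)) - 2 * q + 2 * c * (x + a (2 * real k + 1))"
        unfolding r1 using fy by (simp add: algebra_simps)
      have r2: "a (2 * real (Suc k) + 1) = 2 * c * a (2 * real (Suc k)) - a (2 * real k + 1)"
        using rec[of "2 * real k + 1"] by (simp add: algebra_simps)
      show "x + a (2 * real (Suc k) + 1) =
          - (x + a (2 * real k + 1)) - 2 * p + 2 * c * (y + a (2 * real (Suc k)))"
        unfolding r2 using fx by (simp add: algebra_simps)
    qed
    finally show ?case .
  qed
  have "(2 * real m - 1) * \<theta> = 2 * pi - \<theta>" "sin (2 * real m * \<theta>) = 0"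
    "(2 * real m + 1) * \<theta> = 2 * pi + \<theta>"
    using m\<theta> by (simp_all add: left_diff_distrib distrib_right mult.assoc)
  then have "a (2 * real m) = - y" "a (2 * real m + 1) = - x"
    using s0 by (simp_all add: a_def sin_add sin_diff)
  then show ?thesis using iter[of m] by (simp add: m_def)
qed

lemma geom_act_word_prod:
  assumes C: "coxeter_system G s"
  shows "geom_act G s (word_prod G s u) = word_act G s u"
proof -
  have *: "word_act G s u = word_act G s v" if "cox_rel (cox_ord G s) u v" for u v
    using that by induction (auto simp: word_act_append word_act_relator[OF C] fun_eq_iff)
  have "word_prod G s (SOME v. word_prod G s v = word_prod G s u) = word_prod G s u"
    by (rule someI_ex) blast
  then show ?thesis
    using * C by (simp add: geom_act_def coxeter_system_def)
qed


section \<open>Subword complexes\<close>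

text \<open>The positions of a word \<open>Q\<close> are \<open>1, \<dots>, length Q\<close>.\<close>

definition positions :: "'n list \<Rightarrow> nat set" where
  "positions Q = {1..length Q}"

definition subword :: "'n list \<Rightarrow> nat set \<Rightarrow> 'n list" where
  "subword Q P = nths Q {k. Suc k \<in> P}"

definition subword_complex ::
  "('g, 'b) monoid_scheme \<Rightarrow> ('n \<Rightarrow> 'g) \<Rightarrow> 'n list \<Rightarrow> 'g \<Rightarrow> nat set set" where
  "subword_complex G s Q g =
     {I. I \<subseteq> positions Q \<and>
         (\<exists>u. subseq u (subword Q (positions Q - I)) \<and> reduced_expression G s u g)}"

definition maximal_face :: "'a set set \<Rightarrow> 'a set \<Rightarrow> bool" where
  "maximal_face K I \<longleftrightarrow> I \<in> K \<and> (\<forall>J\<in>K. I \<subseteq> J \<longrightarrow> J = I)"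

text \<open>
  \<open>is_flip K I L L' I'\<close>: the maximal face \<open>I'\<close> of \<open>K\<close> is obtained from the maximal face \<open>I\<close> by
  the flip \<open>\<sigma>\<^bsub>L,L'\<^esub>\<close>, whose degree is \<open>card L\<close>.
\<close>

definition is_flip :: "'a set set \<Rightarrow> 'a set \<Rightarrow> 'a set \<Rightarrow> 'a set \<Rightarrow> 'a set \<Rightarrow> bool" where
  "is_flip K I L L' I' \<longleftrightarrow>
     maximal_face K I \<and> maximal_face K I' \<and> I' \<noteq> I \<and>
     L \<subseteq> I \<and> L' \<subseteq> I' \<and> I - L = I' - L'"

definition is_1_flip :: "'a set set \<Rightarrow> 'a set \<Rightarrow> 'a set \<Rightarrow> 'a set \<Rightarrow> 'a set \<Rightarrow> bool" where
  "is_1_flip K I L L' I' \<longleftrightarrow> is_flip K I L L' I' \<and> card L = 1"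


section \<open>Quadruples\<close>

text \<open>The Coxeter group \<open>W\<^sub>X\<close> comes with its simple reflections.\<close>

record ('g, 'n) quadruple =
  cox_group :: "'g monoid"
  simple_refl :: "'n \<Rightarrow> 'g"
  cox_word :: "'n list"
  cox_elem :: 'g
  facet :: "nat set"

definition X_positions :: "('g, 'n) quadruple \<Rightarrow> nat set" where
  "X_positions X = positions (cox_word X)"

definition X_complex :: "('g, 'n) quadruple \<Rightarrow> nat set set" where
  "X_complex X = subword_complex (cox_group X) (simple_refl X) (cox_word X) (cox_elem X)"

definition is_quadruple :: "('g, 'n::finite) quadruple \<Rightarrow> bool" where
  "is_quadruple X \<longleftrightarrow>
     coxeter_system (cox_group X) (simple_refl X) \<and> cox_elem X \<in> carrier (cox_group X) \<and>
     maximal_face (X_complex X) (facet X)"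

definition root_fun :: "('g, 'n::finite) quadruple \<Rightarrow> nat \<Rightarrow> real ^ 'n" where
  "root_fun X l =
     geom_act (cox_group X) (simple_refl X)
       (word_prod (cox_group X) (simple_refl X) (subword (cox_word X) ({1..l - 1} - facet X)))
       (simple_root (cox_word X ! (l - 1)))"

definition root_span :: "('g, 'n::finite) quadruple \<Rightarrow> nat set \<Rightarrow> (real ^ 'n) set" where
  "root_span X H = span (root_fun X ` H)"

text \<open>The collection \<open>\<C>\<close>; the ambient space \<open>V\<^sub>X\<close> is all of \<open>real ^ 'n\<close>.\<close>

definition irreducible_quadruple :: "('g, 'n::finite) quadruple \<Rightarrow> bool" where
  "irreducible_quadruple X \<longleftrightarrow> is_quadruple X \<and> root_span X (facet X) = UNIV"


section \<open>Flats\<close>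

definition flat_of :: "('g, 'n::finite) quadruple \<Rightarrow> (real ^ 'n) set \<Rightarrow> nat set" where
  "flat_of X V = {i \<in> X_positions X. root_fun X i \<in> V}"

definition is_flat :: "('g, 'n::finite) quadruple \<Rightarrow> nat set \<Rightarrow> bool" where
  "is_flat X F \<longleftrightarrow> (\<exists>V. subspace V \<and> F = flat_of X V)"

definition irreducible_flat :: "('g, 'n::finite) quadruple \<Rightarrow> nat set \<Rightarrow> bool" where
  "irreducible_flat X F \<longleftrightarrow> is_flat X F \<and> root_span X F = root_span X (F \<inter> facet X)"

text \<open>
  The Coxeter group of the quadruple \<open>X\<^sub>F\<close> induced by a flat \<open>F\<close> has the root system
  \<open>\<Phi>\<^sub>X \<inter> root_span X F\<close> in the vector space \<open>root_span X F\<close>.  Its rank \<open>deg X\<^sub>F\<close> is the number of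
  simple roots, which form a basis of that space such that the positive roots are nonnegative
  combinations of it.  Such a set of simple roots is unique if it exists, so \<open>flat_degree\<close> is
  stated as a relation.
\<close>

definition flat_simple_roots :: "('g, 'n::finite) quadruple \<Rightarrow> nat set \<Rightarrow> (real ^ 'n) set \<Rightarrow> bool" where
  "flat_simple_roots X F \<Delta> \<longleftrightarrow>
     (let \<Phi>p = positive_roots (cox_group X) (simple_refl X) \<inter> root_span X F in
        \<Delta> \<subseteq> \<Phi>p \<and> independent \<Delta> \<and> span \<Delta> = root_span X F \<and>
        (\<forall>\<beta>\<in>\<Phi>p. \<exists>c. (\<forall>\<delta>\<in>\<Delta>. 0 \<le> c \<delta>) \<and> \<beta> = (\<Sum>\<delta>\<in>\<Delta>. c \<delta> *\<^sub>R \<delta>)))"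

definition flat_degree :: "('g, 'n::finite) quadruple \<Rightarrow> nat set \<Rightarrow> nat \<Rightarrow> bool" where
  "flat_degree X F d \<longleftrightarrow> (\<exists>\<Delta>. flat_simple_roots X F \<Delta> \<and> card \<Delta> = d)"

definition flippable :: "('g, 'n::finite) quadruple \<Rightarrow> nat set \<Rightarrow> bool" where
  "flippable X F \<longleftrightarrow>
     irreducible_flat X F \<and> flat_degree X F 1 \<and> F \<inter> (X_positions X - facet X) \<noteq> {}"

definition traversing_pos :: "('g, 'n::finite) quadruple \<Rightarrow> nat set \<Rightarrow> nat" where
  "traversing_pos X F = (THE t. t \<in> F \<inter> (X_positions X - facet X))"

definition flip_facet :: "('g, 'n::finite) quadruple \<Rightarrow> nat set \<Rightarrow> nat \<Rightarrow> nat set" where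
  "flip_facet X F i = (facet X - {i}) \<union> {traversing_pos X F}"

definition flip_quadruple ::
  "('g, 'n::finite) quadruple \<Rightarrow> nat set \<Rightarrow> nat \<Rightarrow> ('g, 'n) quadruple" where
  "flip_quadruple X F i = X\<lparr>facet := flip_facet X F i\<rparr>"

end

theory Submission
  imports Defs
begin

text \<open>
  Let \<open>I\<close> be a facet of the subword complex of \<open>Q\<close>; its complement \<open>K\<close> spells a reduced word.
  Exchanging a folded position \<open>i\<close> for a traversing position \<open>t\<close> replaces \<open>K = M \<union> {t}\<close> by
  \<open>M \<union> {i}\<close>, and both sets have the same size, so the exchange is a flip exactly when the two
  subwords represent the same group element.  Inserting a position \<open>a\<close> into \<open>M\<close> multiplies the
  element on the left by the reflection in the root that \<open>M\<close> has at \<open>a\<close>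
  (\<open>act_subword_insert\<close>).  Hence the two elements agree iff the reflections in the roots of \<open>M\<close>
  at \<open>i\<close> and at \<open>t\<close> agree, that is, iff these roots are equal up to sign (\<open>exchange_iff\<close>), and
  this is the same as collinearity of the roots \<open>r(i)\<close> and \<open>r(t)\<close> of \<open>I\<close> itself
  (\<open>collinear_roots_iff\<close>).  So the \<open>1\<close>-flips are the pairs of a folded and a traversing position
  whose roots span the same line (\<open>one_flip_iff\<close>).

  On the side of flats, a flippable flat is the set of positions whose roots lie on the line of
  a root, where both kinds of positions occur among them.  It contains only one traversing position
  because two collinear roots at traversing positions would allow deleting both letters from a
  reduced word (\<open>reduced_roots_not_collinear\<close>).  After the flip every root changes by a multiple
  of the common root, which is still among the new roots, so the span of the roots at the folded
  positions does not shrink (\<open>flip_root_span\<close>).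

  Reading off group elements from their action requires the geometric representation to be
  faithful, and finding the simple root of a rank one flat requires each root to have a sign.
  Both follow from the classical theorem that \<open>w\<close> maps the simple root \<open>\<alpha>\<^sub>i\<close> to a nonnegative
  combination of simple roots unless \<open>w s\<^sub>i\<close> is shorter than \<open>w\<close> (\<open>act_simple_root_nonneg\<close>).
  It is proved by induction on the length of \<open>w\<close>, splitting off a factor from a dihedral
  parabolic subgroup, in which the coefficients are values of Chebyshev polynomials.
\<close>


section \<open>Alternating words and Chebyshev numbers\<close>

fun alternating :: "'a \<Rightarrow> 'a \<Rightarrow> nat \<Rightarrow> 'a list" where
  "alternating a b 0 = []"
| "alternating a b (Suc k) = a # alternating b a k"

lemma length_alternating [simp]: "length (alternating a b k) = k"
  by (induction a b k rule: alternating.induct) auto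

lemma alternating_add:
  "alternating a b (j + k) =
     alternating a b j @ (if even j then alternating a b k else alternating b a k)"
  by (induction a b j rule: alternating.induct) auto

lemma alternating_double: "alternating a b (2 * k) = concat (replicate k [a, b])"
  by (induction k) auto

lemma rev_alternating:
  "rev (alternating a b k) = (if even k then alternating b a k else alternating a b k)"
proof (induction k arbitrary: a b)
  case (Suc k)
  then show ?case
    using alternating_add[of a b k 1] alternating_add[of b a k 1] by auto
qed simp

text \<open>
  The form of a reduced word in two letters: equal letters are never adjacent, so the
  first letter and the length determine the word.
\<close>

lemma alternating_unique:
  assumes "distinct_adj z" "set z \<subseteq> {a, b}" "z \<noteq> [] \<Longrightarrow> hd z = a"
  shows "z = alternating a b (length z)"
  using assms
proof (induction z arbitrary: a b)
  case (Cons c z)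
  have "z = alternating b a (length z)"
    using Cons.prems by (intro Cons.IH) (cases z; auto)+
  then show ?case using Cons.prems by simp
qed simp

lemma not_distinct_adj_split:
  assumes "\<not> distinct_adj y"
  obtains p c q where "y = p @ [c, c] @ q"
  using assms
proof (induction y arbitrary: thesis rule: induct_list012)
  case (3 a b y)
  show ?case
  proof (cases "a = b")
    case True
    then show ?thesis using "3.prems"(1)[of "[]" a y] by simp
  next
    case False
    then have "\<not> distinct_adj (b # y)" using "3.prems"(2) by simp
    with "3.IH"(2) obtain p c q where "b # y = p @ [c, c] @ q" by blast
    then show ?thesis using "3.prems"(1)[of "a # p" c q] by simp
  qed
qed auto

text \<open>
  The values \<open>U\<^sub>k\<^sub>-\<^sub>1(c)\<close> of the Chebyshev polynomials of the second kind: the coefficients of the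
  roots of a dihedral group over its two simple roots.
\<close>

fun cheb :: "real \<Rightarrow> nat \<Rightarrow> real" where
  "cheb c 0 = 0"
| "cheb c (Suc 0) = 1"
| "cheb c (Suc (Suc k)) = 2 * c * cheb c (Suc k) - cheb c k"

text \<open>
  The degenerate case of an infinite dihedral group, where the angle is \<open>0\<close>.
\<close>

lemma cheb_one: "cheb 1 k = real k"
  by (induction "1::real" k rule: cheb.induct) auto

lemma cheb_cos: "sin \<theta> \<noteq> 0 \<Longrightarrow> cheb (cos \<theta>) k = sin (real k * \<theta>) / sin \<theta>"
proof (induction "cos \<theta>" k rule: cheb.induct)
  case (3 k)
  define x where "x = real (Suc k) * \<theta>"
  have "sin (x + \<theta>) = 2 * cos \<theta> * sin x - sin (x - \<theta>)"
    by (simp add: sin_add sin_diff)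
  moreover have "x + \<theta> = real (Suc (Suc k)) * \<theta>" "x - \<theta> = real k * \<theta>"
    by (simp_all add: x_def algebra_simps)
  ultimately have "sin (real (Suc (Suc k)) * \<theta>) = 2 * cos \<theta> * sin x - sin (real k * \<theta>)"
    by simp
  with 3 show ?case by (simp add: x_def diff_divide_distrib del: of_nat_Suc)
qed auto

text \<open>
  Only the first \<open>m\<close> multiples of the angle \<open>pi / m\<close> stay in the half plane where the sine is
  nonnegative; this is where the bound on the length of dihedral elements enters.
  For \<open>m = 0\<close>, which encodes an infinite order, \<open>pi / 0 = 0\<close> and the numbers are \<open>0, 1, 2, \<dots>\<close>.
\<close>

lemma cheb_nonneg:
  assumes "m \<noteq> 1" "m = 0 \<or> k \<le> m"
  shows "0 \<le> cheb (cos (pi / real m)) k"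
proof (cases "m = 0")
  case True
  then show ?thesis by (simp add: cheb_one)
next
  case False
  define \<theta> where "\<theta> = pi / real m"
  have m: "m \<ge> 2" "k \<le> m" using False assms by auto
  then have \<theta>: "0 < \<theta>" "\<theta> < pi" by (simp_all add: \<theta>_def divide_less_eq)
  have "real k * \<theta> \<le> real m * \<theta>" using m \<theta> by (intro mult_right_mono) auto
  also have "\<dots> = pi" using m by (simp add: \<theta>_def)
  finally have "0 \<le> sin (real k * \<theta>)" using \<theta> by (intro sin_ge_zero) auto
  moreover have "0 < sin \<theta>" using \<theta> by (rule sin_gt_zero)
  ultimately show ?thesis using cheb_cos[of \<theta> k] by (simp add: \<theta>_def)
qed


section \<open>Words and the geometric action\<close>

locale coxeter =
  fixes G :: "('g, 'b) monoid_scheme" and s :: "'n::finite \<Rightarrow> 'g"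
  assumes system: "coxeter_system G s"
begin

sublocale group G
  using system by (simp add: coxeter_system_def)

abbreviation wp :: "'n list \<Rightarrow> 'g" where "wp \<equiv> word_prod G s"
abbreviation act :: "'n list \<Rightarrow> real ^ 'n \<Rightarrow> real ^ 'n" where "act \<equiv> word_act G s"
abbreviation form :: "real ^ 'n \<Rightarrow> real ^ 'n \<Rightarrow> real" where "form \<equiv> cox_form G s"

abbreviation reduced :: "'n list \<Rightarrow> bool" where
  "reduced u \<equiv> reduced_expression G s u (wp u)"

lemma s_closed [simp]: "s i \<in> carrier G"
  using system by (auto simp: coxeter_system_def)

lemma wp_Nil [simp]: "wp [] = \<one>\<^bsub>G\<^esub>"
  by (simp add: word_prod_def)

lemma wp_Cons [simp]: "wp (i # u) = s i \<otimes>\<^bsub>G\<^esub> wp u"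
  by (simp add: word_prod_def)

lemma wp_closed [simp]: "wp u \<in> carrier G"
  by (induction u) auto

lemma wp_append [simp]: "wp (u @ v) = wp u \<otimes>\<^bsub>G\<^esub> wp v"
  by (induction u) (auto simp: m_assoc)

lemma s_square [simp]: "s i \<otimes>\<^bsub>G\<^esub> s i = \<one>\<^bsub>G\<^esub>"
  by (rule cox_ord_self(1)[OF system])

lemma s_cancel [simp]: "x \<in> carrier G \<Longrightarrow> s i \<otimes>\<^bsub>G\<^esub> (s i \<otimes>\<^bsub>G\<^esub> x) = x"
  by (simp flip: m_assoc)

lemma wp_rev: "wp (rev u) = inv\<^bsub>G\<^esub> (wp u)"
proof (induction u)
  case (Cons i u)
  have "inv\<^bsub>G\<^esub> (s i) = s i" by (rule inv_equality) auto
  with Cons show ?case by (simp add: inv_mult_group)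
qed simp

lemma act_eqI: "wp u = wp v \<Longrightarrow> act u = act v"
  by (metis geom_act_word_prod system)

lemma act_Nil [simp]: "act [] v = v"
  by (simp add: word_act_def)

lemma act_Cons: "act (i # u) v = simple_reflection G s i (act u v)"
  by (simp add: word_act_def)

lemma reduced_le: "reduced u \<Longrightarrow> wp v = wp u \<Longrightarrow> length u \<le> length v"
  by (simp add: reduced_expression_def)

lemma exists_reduced: "\<exists>v. wp v = wp u \<and> reduced v"
proof -
  obtain v where "wp v = wp u" "\<forall>v'. wp v' = wp u \<longrightarrow> length v \<le> length v'"
    using ex_has_least_nat[of "\<lambda>v. wp v = wp u" u length] by blast
  then show ?thesis by (auto simp: reduced_expression_def)
qed

lemma form_commute: "form v w = form w v"
  unfolding cox_form_def
  by (subst sum.swap) (simp add: cox_ord_commute[OF system] mult_ac)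

lemma form_simple_self [simp]: "form (simple_root i) (simple_root i) = 1"
  by (simp add: cox_form_simple cox_ord_self(2)[OF system])

lemma form_diff_right: "form u (v - c *\<^sub>R w) = form u v - c * form u w"
  using cox_form_add_right[of G s u v "(- c) *\<^sub>R w"]
  by (simp only: cox_form_scale_right) simp

lemma form_diff_left: "form (v - c *\<^sub>R w) u = form v u - c * form w u"
  by (simp add: form_commute[of _ u] form_diff_right)

lemma linear_act: "linear (act u)"
proof (induction u)
  case Nil
  have "act [] = id" by auto
  then show ?case by (simp only: linear_id)
next
  case (Cons i u)
  have "linear (simple_reflection G s i)"
    by (rule linearI)
      (simp_all add: simple_reflection_def cox_form_add_right cox_form_scale_right algebra_simps)
  then show ?case
    using linear_compose[OF Cons] by (simp add: act_Cons[abs_def] o_def)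
qed

lemma form_act: "form (act u v) (act u w) = form v w"
proof (induction u)
  case (Cons i u)
  have "form (simple_reflection G s i v) (simple_reflection G s i w) = form v w" for v w
    by (simp add: simple_reflection_def form_diff_left form_diff_right
        form_commute[of v "simple_root i"] algebra_simps)
  with Cons show ?case by (simp add: act_Cons)
qed simp

lemma act_rev_act: "act (rev u) (act u v) = v"
proof -
  have "act (rev u @ u) = act []"
    by (rule act_eqI) (simp add: wp_rev)
  then show ?thesis by (metis act_Nil word_act_append)
qed

definition refl :: "real ^ 'n \<Rightarrow> real ^ 'n \<Rightarrow> real ^ 'n" where
  "refl \<beta> v = v - (2 * form \<beta> v) *\<^sub>R \<beta>"

lemma simple_reflection_refl: "simple_reflection G s i = refl (simple_root i)"
  by (simp add: refl_def simple_reflection_def fun_eq_iff)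

text \<open>
  Invariance of the form makes the conjugate of a reflection the reflection in the image root.
\<close>

lemma act_refl: "act u (refl \<beta> v) = refl (act u \<beta>) (act u v)"
  using linear_act[of u]
  by (simp add: refl_def form_act linear_diff linear_cmul)

lemma refl_refl:
  assumes "form \<beta> \<beta> = 1"
  shows "refl \<beta> (refl \<beta> v) = v"
  by (simp add: refl_def form_diff_right assms algebra_simps flip: scaleR_add_left)

lemma refl_self: "form \<beta> \<beta> = 1 \<Longrightarrow> refl \<beta> \<beta> = - \<beta>"
  by (simp add: refl_def algebra_simps scaleR_2)

lemma refl_uminus: "refl (- \<beta>) = refl \<beta>"
  using cox_form_scale_right[of G s _ "-1" \<beta>]
  by (simp add: refl_def fun_eq_iff form_commute[of _ _])

lemma form_root [simp]: "form (act u (simple_root i)) (act u (simple_root i)) = 1"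
  by (simp add: form_act)

lemma act_snoc_simple_root: "act (u @ [i]) (simple_root i) = - act u (simple_root i)"
  using linear_act[of u]
  by (simp add: word_act_append act_Cons simple_reflection_refl refl_self linear_neg)


section \<open>Signs of roots\<close>

text \<open>
  The alternating word of length \<open>2 m\<close> is trivial, and its second half is the reverse of the
  other alternating word of length \<open>m\<close>.
\<close>

lemma braid_relation:
  "wp (alternating i j (cox_ord G s i j)) = wp (alternating j i (cox_ord G s i j))"
proof -
  let ?m = "cox_ord G s i j"
  have pow: "wp (concat (replicate k [i, j])) = (s i \<otimes>\<^bsub>G\<^esub> s j) [^]\<^bsub>G\<^esub> k" for k
  proof (induction k)
    case (Suc k)
    then show ?case
      using nat_pow_Suc2[of "s i \<otimes>\<^bsub>G\<^esub> s j" k] by (simp add: m_assoc)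
  qed simp
  have "wp (alternating i j (?m + ?m)) = \<one>\<^bsub>G\<^esub>"
    using alternating_double[of i j ?m] pow[of ?m] pow_ord_eq_1[of "s i \<otimes>\<^bsub>G\<^esub> s j"]
    by (simp add: cox_ord_def mult_2)
  then have "wp (alternating i j ?m) \<otimes>\<^bsub>G\<^esub>
      wp (if even ?m then alternating i j ?m else alternating j i ?m) = \<one>\<^bsub>G\<^esub>"
    by (simp only: alternating_add wp_append)
  then have "inv\<^bsub>G\<^esub> (wp (alternating i j ?m)) =
      wp (if even ?m then alternating i j ?m else alternating j i ?m)"
    by (metis wp_closed inv_equality inv_comm)
  then show ?thesis
    by (auto simp flip: wp_rev simp: rev_alternating split: if_splits)
qed

text \<open>
  Each further letter shifts the pair of consecutive Chebyshev numbers by one and swaps the two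
  simple roots, which is why the final roots \<open>a\<close>, \<open>b\<close> are only determined up to order.  The
  general start \<open>n\<close> makes the induction work; \<open>n = 0\<close> is the simple root itself.
\<close>

lemma act_alternating:
  fixes i j :: 'n
  defines "c \<equiv> cos (pi / real (cox_ord G s i j))"
  shows "\<exists>a b. {a, b} = {i, j} \<and>
    act (rev (alternating j i k)) (cheb c (Suc n) *\<^sub>R simple_root i + cheb c n *\<^sub>R simple_root j) =
    cheb c (Suc (n + k)) *\<^sub>R simple_root a + cheb c (n + k) *\<^sub>R simple_root b"
  unfolding c_def
proof (induction k arbitrary: i j n)
  case 0
  then show ?case by auto
next
  case (Suc k)
  let ?c = "cos (pi / real (cox_ord G s i j))"
  have c: "cos (pi / real (cox_ord G s j i)) = ?c"
    by (simp add: cox_ord_commute[OF system, of j i])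
  have step: "simple_reflection G s j
        (cheb ?c (Suc n) *\<^sub>R simple_root i + cheb ?c n *\<^sub>R simple_root j) =
      cheb ?c (Suc (Suc n)) *\<^sub>R simple_root j + cheb ?c (Suc n) *\<^sub>R simple_root i"
    by (simp add: simple_reflection_def cox_form_add_right cox_form_scale_right cox_form_simple
        cox_ord_self(2)[OF system] c)
      (simp add: vec_eq_iff algebra_simps)
  have "act (rev (alternating j i (Suc k)))
        (cheb ?c (Suc n) *\<^sub>R simple_root i + cheb ?c n *\<^sub>R simple_root j) =
      act (rev (alternating i j k))
        (cheb ?c (Suc (Suc n)) *\<^sub>R simple_root j + cheb ?c (Suc n) *\<^sub>R simple_root i)"
    by (simp only: alternating.simps rev.simps word_act_append act_Cons act_Nil step)
  moreover obtain a b where "{a, b} = {j, i}"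
    "act (rev (alternating i j k))
        (cheb ?c (Suc (Suc n)) *\<^sub>R simple_root j + cheb ?c (Suc n) *\<^sub>R simple_root i) =
     cheb ?c (Suc (Suc n + k)) *\<^sub>R simple_root a + cheb ?c (Suc n + k) *\<^sub>R simple_root b"
    using Suc.IH[of j i "Suc n"] unfolding c by blast
  ultimately show ?case by (metis add_Suc add_Suc_right insert_commute)
qed

text \<open>
  Let \<open>j\<close> be the last letter of \<open>w\<close>.  Among the factorisations \<open>w = x y\<close> with additive lengths and
  \<open>y\<close> a word in \<open>i\<close> and \<open>j\<close>, the one with \<open>x\<close> shortest has \<open>x\<close> ascending in both directions, so
  by induction \<open>x\<close> maps \<open>\<alpha>\<^sub>i\<close> and \<open>\<alpha>\<^sub>j\<close> to nonnegative vectors.  The factor \<open>y\<close> cannot be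
  rewritten to end in \<open>i\<close>, as \<open>w s\<^sub>i\<close> would then be shorter than \<open>w\<close>; hence it is an alternating word ending in \<open>j\<close> that is shorter than the
  order of \<open>s\<^sub>j s\<^sub>i\<close>, and it maps \<open>\<alpha>\<^sub>i\<close> to a nonnegative combination of \<open>\<alpha>\<^sub>i\<close> and \<open>\<alpha>\<^sub>j\<close>.
\<close>

lemma act_simple_root_nonneg:
  assumes "reduced w" "\<And>v. wp v = wp (w @ [i]) \<Longrightarrow> length w \<le> length v"
  shows "0 \<le> act w (simple_root i) $ k"
  using assms
proof (induction w arbitrary: i rule: length_induct)
  case (1 w)
  note red = "1.prems"(1) and asc = "1.prems"(2)
  show ?case
  proof (cases w rule: rev_cases)
    case Nil
    then show ?thesis by (simp add: axis_def)
  next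
    case (snoc w0 j)
    have ij: "j \<noteq> i"
      using asc[of w0] by (auto simp: snoc m_assoc)
    define P where "P x \<longleftrightarrow> (\<exists>y. set y \<subseteq> {i, j} \<and> wp (x @ y) = wp w \<and>
        length x + length y = length w)" for x
    have "P w0" unfolding P_def by (rule exI[of _ "[j]"]) (simp add: snoc)
    then obtain x where "P x" and min: "\<And>x'. P x' \<Longrightarrow> length x \<le> length x'"
      using ex_has_least_nat[of P w0 length] by blast
    then obtain y where y: "set y \<subseteq> {i, j}" "wp (x @ y) = wp w"
        "length x + length y = length w"
      unfolding P_def by blast
    have short: "length x < length w" using min[OF \<open>P w0\<close>] by (simp add: snoc)
    have "reduced x"
      unfolding reduced_expression_def
    proof (intro conjI allI impI refl)
      fix v assume "wp v = wp x"
      then have "wp (v @ y) = wp w" using y(2) by simp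
      then show "length x \<le> length v" using reduced_le[OF red, of "v @ y"] y(3) by simp
    qed
    moreover have "length x \<le> length v" if l: "l \<in> {i, j}" and v: "wp v = wp (x @ [l])" for l v
    proof (rule ccontr)
      assume less: "\<not> length x \<le> length v"
      \<comment> \<open>Moving the letter \<open>l\<close> from \<open>x\<close> to \<open>y\<close> then gives a factorisation with a shorter first factor.\<close>
      have "wp (v @ l # y) = wp w" using v y(2) by (simp add: m_assoc)
      moreover from this have "length v + length (l # y) = length w"
        using reduced_le[OF red, of "v @ l # y"] less y(3) by simp
      moreover have "set (l # y) \<subseteq> {i, j}" using l y(1) by auto
      ultimately have "P v" unfolding P_def by blast
      then show False using min less by blast
    qed
    ultimately have x_nonneg: "0 \<le> act x (simple_root l) $ k" if "l \<in> {i, j}" for l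
      using "1.IH" short that by blast
    have y_ne: "y \<noteq> []" using short y(3) by auto
    have "last y \<noteq> i"
    proof
      assume "last y = i"
      then obtain z where z: "y = z @ [i]" using y_ne by (metis append_butlast_last_id)
      then have "wp (w @ [i]) = wp (x @ z)"
        using y(2) by (simp add: m_assoc flip: y(2))
      then have "length w \<le> length (x @ z)" by (intro asc) simp
      then show False using y(3) by (simp add: z)
    qed
    moreover have "distinct_adj y"
    proof (rule ccontr)
      assume "\<not> distinct_adj y"
      then obtain p c q where yc: "y = p @ [c, c] @ q" by (rule not_distinct_adj_split)
      then have "wp (x @ p @ q) = wp w" using y(2) by (simp add: m_assoc)
      then show False using reduced_le[OF red, of "x @ p @ q"] y(3) by (simp add: yc)
    qed
    moreover from calculation(1) have "last y = j"
      using last_in_set[OF y_ne] y(1) by blast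
    ultimately have "rev y = alternating j i (length (rev y))"
      using y_ne y(1) by (intro alternating_unique) (auto simp: hd_rev)
    then have y_alt: "y = rev (alternating j i (length y))"
      by (metis length_rev rev_swap)
    define m where "m = cox_ord G s j i"
    have m1: "m \<noteq> 1" unfolding m_def by (rule cox_ord_neq_1[OF system ij])
    \<comment> \<open>Otherwise the braid relation replaces the end of \<open>y\<close> by a word ending in \<open>i\<close>.\<close>
    have y_len: "m = 0 \<or> length y < m"
    proof (rule ccontr)
      assume "\<not> (m = 0 \<or> length y < m)"
      then obtain m' r where m': "m = Suc m'" and r: "length y = m + r"
        by (metis le_Suc_ex linorder_not_less not0_implies_Suc)
      obtain y0 where y0: "y = y0 @ rev (alternating j i m)"
        using y_alt unfolding r alternating_add by simp
      have "wp (rev (alternating j i m)) = wp (rev (alternating i j m))"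
        using braid_relation[of j i] unfolding m_def by (simp add: wp_rev)
      also have "\<dots> = wp (rev (alternating j i m')) \<otimes>\<^bsub>G\<^esub> s i" by (simp add: m')
      finally have "wp (w @ [i]) = wp (x @ y0 @ rev (alternating j i m'))"
        using y(2) by (simp add: y0 m_assoc flip: y(2))
      then have "length w \<le> length (x @ y0 @ rev (alternating j i m'))" by (intro asc) simp
      then show False using y(3) m' by (simp add: y0)
    qed
    let ?c = "cos (pi / real m)"
    have "cos (pi / real (cox_ord G s i j)) = ?c"
      by (simp add: m_def cox_ord_commute[OF system, of i j])
    then obtain a b where ab: "{a, b} = {i, j}" and
      y_act: "act y (simple_root i) = cheb ?c (Suc (length y)) *\<^sub>R simple_root a +
        cheb ?c (length y) *\<^sub>R simple_root b"
      using act_alternating[of i j "length y" 0] y_alt by auto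
    have "act w (simple_root i) = act x (act y (simple_root i))"
      using act_eqI[OF y(2)] by (metis word_act_append)
    also have "\<dots> = cheb ?c (Suc (length y)) *\<^sub>R act x (simple_root a) +
        cheb ?c (length y) *\<^sub>R act x (simple_root b)"
      using linear_act[of x] by (simp add: y_act linear_add linear_cmul)
    finally show ?thesis
      using cheb_nonneg[OF m1, of "Suc (length y)"] cheb_nonneg[OF m1, of "length y"]
        x_nonneg[of a] x_nonneg[of b] ab y_len by fastforce
  qed
qed

text \<open>
  Of \<open>w\<close> and \<open>w s\<^sub>i\<close> the one of smaller length maps \<open>\<alpha>\<^sub>i\<close> to a nonnegative vector, and the other
  one maps it to the opposite vector.
\<close>

lemma root_sign:
  "(\<forall>k. 0 \<le> act u (simple_root i) $ k) \<or> (\<forall>k. act u (simple_root i) $ k \<le> 0)"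
proof -
  obtain w where w: "wp w = wp u" "reduced w" using exists_reduced by blast
  obtain v where v: "wp v = wp (w @ [i])" "reduced v" using exists_reduced by blast
  have w_eq: "wp (v @ [i]) = wp w" using v(1) by (simp add: m_assoc)
  consider "length w \<le> length v" | "length v \<le> length w" by linarith
  then show ?thesis
  proof cases
    case 1
    then have "0 \<le> act w (simple_root i) $ k" for k
      using w(2) v(1) reduced_le[OF v(2)] by (intro act_simple_root_nonneg) (auto, fastforce)
    then show ?thesis using act_eqI[OF w(1)] by simp
  next
    case 2
    then have "0 \<le> act v (simple_root i) $ k" for k
      using v(2) w w_eq reduced_le[OF w(2)] by (intro act_simple_root_nonneg) (auto, fastforce)
    moreover have "act u (simple_root i) = - act v (simple_root i)"
      using act_eqI[OF w_eq] act_eqI[OF w(1)] act_snoc_simple_root[of v i] by simp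
    ultimately show ?thesis by simp
  qed
qed

text \<open>
  A nonempty reduced word sends the simple root of its last letter to a negative vector, so it
  does not act trivially.
\<close>

lemma act_faithful:
  assumes "act u = act v"
  shows "wp u = wp v"
proof -
  obtain w where w: "wp w = wp (rev v @ u)" "reduced w" using exists_reduced by blast
  have w_id: "act w x = x" for x
    using act_eqI[OF w(1)] assms by (simp add: word_act_append act_rev_act)
  have "w = []"
  proof (cases w rule: rev_cases)
    case (snoc w0 i)
    have red: "length w0 < length z" if "wp z = wp (w0 @ [i])" for z
      using reduced_le[OF w(2), of z] that by (simp add: snoc)
    have "reduced w0"
      unfolding reduced_expression_def
    proof (intro conjI allI impI refl)
      fix z assume "wp z = wp w0"
      then show "length w0 \<le> length z" using red[of "z @ [i]"] by simp
    qed
    then have "0 \<le> act w0 (simple_root i) $ i"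
      using red by (intro act_simple_root_nonneg) (auto intro: less_imp_le)
    moreover have "act w0 (simple_root i) = - simple_root i"
      using w_id[of "simple_root i"] act_snoc_simple_root[of w0 i]
      by (simp add: snoc) (metis minus_minus)
    ultimately show ?thesis by (simp add: axis_def)
  qed simp
  then have "inv\<^bsub>G\<^esub> (wp v) \<otimes>\<^bsub>G\<^esub> wp u = \<one>\<^bsub>G\<^esub>" using w(1) by (simp add: wp_rev)
  then show ?thesis by (metis inv_closed inv_equality inv_inv wp_closed inv_comm)
qed

end


section \<open>Subwords and facets\<close>

lemma subword_snoc:
  "subword (Q @ [c]) K = subword Q K @ (if Suc (length Q) \<in> K then [c] else [])"
  by (simp add: subword_def nths_append nths_singleton)

lemma subword_cong:
  "(\<And>k. k \<in> positions Q \<Longrightarrow> k \<in> K \<longleftrightarrow> k \<in> K') \<Longrightarrow> subword Q K = subword Q K'"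
proof (induction Q rule: rev_induct)
  case (snoc c Q)
  then have "subword Q K = subword Q K'" by (auto simp: positions_def)
  moreover have "Suc (length Q) \<in> K \<longleftrightarrow> Suc (length Q) \<in> K'"
    using snoc.prems by (auto simp: positions_def)
  ultimately show ?case by (simp add: subword_snoc)
qed (simp add: subword_def)

lemma subword_outside: "(\<And>k. k \<in> positions Q \<Longrightarrow> k \<notin> K) \<Longrightarrow> subword Q K = []"
  using subword_cong[of Q K "{}"] by (simp add: subword_def)

lemma length_subword: "length (subword Q K) = card (positions Q \<inter> K)"
proof (induction Q rule: rev_induct)
  case (snoc c Q)
  have "positions (Q @ [c]) \<inter> K =
      (if Suc (length Q) \<in> K then insert (Suc (length Q)) (positions Q \<inter> K) else positions Q \<inter> K)"
    by (auto simp: positions_def le_Suc_eq Suc_le_eq)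
  with snoc show ?case by (simp add: subword_snoc) (simp add: positions_def)
qed (simp add: subword_def positions_def)

lemma subword_split:
  assumes "a \<in> positions Q"
  shows "subword Q K =
    subword Q (K \<inter> {..<a}) @ (if a \<in> K then [Q ! (a - 1)] else []) @ subword Q (K \<inter> {a<..})"
  using assms
proof (induction Q rule: rev_induct)
  case (snoc c Q)
  show ?case
  proof (cases "a = Suc (length Q)")
    case True
    have "subword Q K = subword Q (K \<inter> {..<a})"
      by (rule subword_cong) (auto simp: positions_def True)
    moreover have "subword (Q @ [c]) (K \<inter> {a<..}) = []"
      by (rule subword_outside) (auto simp: positions_def True)
    ultimately show ?thesis by (simp add: subword_snoc True)
  next
    case False
    then have a: "a \<in> positions Q" "1 \<le> a" "a \<le> length Q"
      using snoc.prems by (auto simp: positions_def)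
    then have "(Q @ [c]) ! (a - 1) = Q ! (a - 1)"
      by (auto simp: nth_append)
    then show ?thesis using a by (subst subword_snoc, subst snoc.IH) (auto simp: subword_snoc)
  qed
qed (simp add: positions_def)

text \<open>
  Choosing a subsequence of a subword amounts to enlarging the face to one whose complement
  spells it.
\<close>

lemma subword_complex_iff:
  "I \<in> subword_complex G s Q g \<longleftrightarrow>
     (\<exists>J. I \<subseteq> J \<and> J \<subseteq> positions Q \<and> reduced_expression G s (subword Q (- J)) g)"
proof
  assume "I \<in> subword_complex G s Q g"
  then obtain u where I: "I \<subseteq> positions Q" and u: "subseq u (subword Q (positions Q - I))"
    "reduced_expression G s u g"
    by (auto simp: subword_complex_def)
  define A where "A = {k. Suc k \<in> positions Q - I}"
  obtain N where N: "u = nths (nths Q A) N"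
    using u(1) unfolding subseq_conv_nths subword_def A_def by blast
  define B where "B = {i \<in> A. \<exists>j\<in>N. card {i' \<in> A. i' < i} = j}"
  have B: "B \<subseteq> A" "u = nths Q B"
    using N nths_nths[of Q A N] by (auto simp: B_def)
  have "u = subword Q (Suc ` B)"
    by (simp add: B(2) subword_def inj_image_mem_iff)
  also have "\<dots> = subword Q (- (positions Q - Suc ` B))"
    by (rule subword_cong) auto
  finally have "reduced_expression G s (subword Q (- (positions Q - Suc ` B))) g"
    using u(2) by simp
  moreover have "I \<subseteq> positions Q - Suc ` B" using I B(1) by (auto simp: A_def)
  ultimately show "\<exists>J. I \<subseteq> J \<and> J \<subseteq> positions Q \<and> reduced_expression G s (subword Q (- J)) g"
    by blast
next
  assume "\<exists>J. I \<subseteq> J \<and> J \<subseteq> positions Q \<and> reduced_expression G s (subword Q (- J)) g"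
  then obtain J where J: "I \<subseteq> J" "J \<subseteq> positions Q" "reduced_expression G s (subword Q (- J)) g"
    by blast
  have "subword Q (- J) = subword Q ((positions Q - I) \<inter> - J)"
    using J(1) by (intro subword_cong) auto
  also have "subseq \<dots> (subword Q (positions Q - I))"
  proof (induction Q rule: rev_induct)
    case (snoc c Q)
    have *: "subword Q (positions (Q @ [c]) - I) = subword Q (positions Q - I)"
      "subword Q ((positions (Q @ [c]) - I) \<inter> - J) = subword Q ((positions Q - I) \<inter> - J)"
      by (rule subword_cong; auto simp: positions_def)+
    show ?case
      unfolding subword_snoc * by (rule list_emb_append_mono[OF snoc]) auto
  qed (simp add: subword_def)
  finally show "I \<in> subword_complex G s Q g"
    using J by (auto simp: subword_complex_def)
qed

lemma reduced_expression_length: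
  "reduced_expression G s u g \<Longrightarrow> reduced_expression G s v g \<Longrightarrow> length u = length v"
  unfolding reduced_expression_def by (intro le_antisym) auto

lemma card_facet:
  assumes "I \<subseteq> positions Q"
  shows "card I + length (subword Q (- I)) = length Q"
proof -
  have "card (positions Q \<inter> - I) = length Q - card I"
    using card_Diff_subset[OF finite_subset[OF assms]] assms
    by (simp add: positions_def Diff_eq)
  moreover have "card I \<le> length Q"
    using card_mono[of "positions Q" I] assms by (simp add: positions_def)
  ultimately show ?thesis by (simp add: length_subword)
qed

text \<open>
  Faces with a reduced complement all have the same size, because reduced expressions of one
  element have the same length; so none of them contains another.
\<close>

lemma maximal_face_iff:
  "maximal_face (subword_complex G s Q g) I \<longleftrightarrow>
     I \<subseteq> positions Q \<and> reduced_expression G s (subword Q (- I)) g"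
proof
  assume "maximal_face (subword_complex G s Q g) I"
  then have "I \<in> subword_complex G s Q g"
    and max: "\<And>J. J \<in> subword_complex G s Q g \<Longrightarrow> I \<subseteq> J \<Longrightarrow> J = I"
    by (auto simp: maximal_face_def)
  then obtain J where J: "I \<subseteq> J" "J \<subseteq> positions Q" "reduced_expression G s (subword Q (- J)) g"
    by (auto simp: subword_complex_iff)
  then have "J \<in> subword_complex G s Q g"
    by (auto simp: subword_complex_iff)
  then have "J = I" using J(1) by (rule max)
  then show "I \<subseteq> positions Q \<and> reduced_expression G s (subword Q (- I)) g"
    using J by simp
next
  assume I: "I \<subseteq> positions Q \<and> reduced_expression G s (subword Q (- I)) g"
  show "maximal_face (subword_complex G s Q g) I"
    unfolding maximal_face_def
  proof (intro conjI ballI impI)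
    show "I \<in> subword_complex G s Q g" using I by (auto simp: subword_complex_iff)
    fix J' assume "J' \<in> subword_complex G s Q g" "I \<subseteq> J'"
    then obtain J where J: "J' \<subseteq> J" "J \<subseteq> positions Q" "reduced_expression G s (subword Q (- J)) g"
      by (auto simp: subword_complex_iff)
    have "card I = card J"
      using card_facet[of I Q] card_facet[OF J(2)] I reduced_expression_length[OF J(3)]
      by (metis add_right_cancel)
    moreover have "finite J" using J(2) by (rule finite_subset) (simp add: positions_def)
    ultimately have "I = J" using J(1) \<open>I \<subseteq> J'\<close> by (intro card_subset_eq) auto
    then show "J' = I" using J(1) \<open>I \<subseteq> J'\<close> by simp
  qed
qed


section \<open>Roots along a word\<close>

context coxeter
begin

text \<open>
  The root function for an arbitrary set \<open>K\<close> of traversed positions.  Flips are compared with the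
  set of positions traversed both before and after, which need not be the complement of a face.
\<close>

definition root_at :: "'n list \<Rightarrow> nat set \<Rightarrow> nat \<Rightarrow> real ^ 'n" where
  "root_at Q K l = act (subword Q (K \<inter> {..<l})) (simple_root (Q ! (l - 1)))"

lemma form_root_at [simp]: "form (root_at Q K l) (root_at Q K l) = 1"
  by (simp add: root_at_def)

text \<open>
  Writing the subword as \<open>u v\<close> with the position \<open>a\<close> in between, \<open>u s v\<close> is \<open>u v\<close> multiplied on the
  left by the conjugate \<open>u s u\<^sup>-\<^sup>1\<close>.
\<close>

lemma act_subword_insert:
  assumes "a \<in> positions Q" "a \<notin> K"
  shows "act (subword Q (insert a K)) v = refl (root_at Q K a) (act (subword Q K) v)"
proof -
  define A C where "A = subword Q (K \<inter> {..<a})" and "C = subword Q (K \<inter> {a<..})"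
  have "insert a K \<inter> {..<a} = K \<inter> {..<a}" "insert a K \<inter> {a<..} = K \<inter> {a<..}" by auto
  then have "subword Q (insert a K) = A @ [Q ! (a - 1)] @ C"
    using subword_split[OF assms(1), of "insert a K"] by (simp add: A_def C_def)
  moreover have "subword Q K = A @ C"
    using subword_split[OF assms(1), of K] assms(2) by (simp add: A_def C_def)
  moreover have "root_at Q K a = act A (simple_root (Q ! (a - 1)))"
    by (simp add: root_at_def A_def)
  ultimately show ?thesis
    by (simp only: word_act_append act_Cons act_Nil simple_reflection_refl act_refl)
qed

lemma root_at_insert:
  assumes "a \<in> positions Q" "a \<notin> K"
  shows "root_at Q (insert a K) l =
    (if a < l then refl (root_at Q K a) (root_at Q K l) else root_at Q K l)"
proof (cases "a < l")
  case True
  then have "insert a K \<inter> {..<l} = insert a (K \<inter> {..<l})" and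
    "K \<inter> {..<l} \<inter> {..<a} = K \<inter> {..<a}" by auto
  then have "root_at Q (insert a K) l =
      act (subword Q (insert a (K \<inter> {..<l}))) (simple_root (Q ! (l - 1)))"
    and "root_at Q (K \<inter> {..<l}) a = root_at Q K a"
    by (simp_all only: root_at_def)
  moreover have new: "a \<notin> K \<inter> {..<l}" using assms(2) by blast
  ultimately have "root_at Q (insert a K) l =
      refl (root_at Q K a) (act (subword Q (K \<inter> {..<l})) (simple_root (Q ! (l - 1))))"
    by (simp only: act_subword_insert[OF assms(1) new])
  then show ?thesis
    using True by (simp only: root_at_def[of Q K l] if_True)
next
  case False
  then have "insert a K \<inter> {..<l} = K \<inter> {..<l}" by auto
  then show ?thesis using False by (simp add: root_at_def)
qed

lemma unit_collinear:
  assumes "form \<beta> \<beta> = 1" "form \<gamma> \<gamma> = 1" "\<beta> = c *\<^sub>R \<gamma>"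
  shows "\<beta> \<in> {\<gamma>, - \<gamma>}"
proof -
  have "form \<beta> \<beta> = c * c"
    using assms(2) unfolding assms(3)
    by (simp add: cox_form_scale_right form_commute[of "c *\<^sub>R \<gamma>"])
  then have "(c - 1) * (c + 1) = 0" using assms(1) by (simp add: algebra_simps)
  then show ?thesis using assms(3) by (auto simp: add_eq_0_iff)
qed

text \<open>
  Apply the common reflection to \<open>\<beta>\<close>, which it negates.
\<close>

lemma refl_eq_imp_collinear:
  assumes "form \<beta> \<beta> = 1" "form \<gamma> \<gamma> = 1" "refl \<beta> = refl \<gamma>"
  shows "\<beta> \<in> {\<gamma>, - \<gamma>}"
proof -
  have "2 *\<^sub>R \<beta> = (2 * form \<gamma> \<beta>) *\<^sub>R \<gamma>"
    using refl_self[OF assms(1)] unfolding assms(3) refl_def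
    by (simp add: algebra_simps scaleR_2)
  from arg_cong[OF this, of "\<lambda>v. (1 / 2) *\<^sub>R v"]
  have "\<beta> = form \<gamma> \<beta> *\<^sub>R \<gamma>" by simp
  then show ?thesis using assms(1,2) by (rule unit_collinear[rotated 2])
qed

lemma refl_collinear_cong: "\<beta> \<in> {\<gamma>, - \<gamma>} \<Longrightarrow> refl \<beta> = refl \<gamma>"
  by (auto simp: refl_uminus)

lemma linear_refl: "linear (refl \<gamma>)"
  by (rule linearI) (simp_all add: refl_def cox_form_add_right cox_form_scale_right algebra_simps)

lemma refl_collinear_iff:
  assumes "form \<gamma> \<gamma> = 1"
  shows "refl \<gamma> \<beta> \<in> {\<gamma>, - \<gamma>} \<longleftrightarrow> \<beta> \<in> {\<gamma>, - \<gamma>}"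
proof -
  have "refl \<gamma> \<beta> = v \<longleftrightarrow> \<beta> = refl \<gamma> v" for v
    using refl_refl[OF assms] by metis
  moreover have "refl \<gamma> (- \<gamma>) = \<gamma>"
    using linear_neg[OF linear_refl, of \<gamma> \<gamma>] refl_self[OF assms] by simp
  ultimately show ?thesis using refl_self[OF assms] by auto
qed

lemma root_at_own [simp]: "root_at Q (insert a K) a = root_at Q K a"
proof -
  have "insert a K \<inter> {..<a} = K \<inter> {..<a}" by auto
  then show ?thesis by (simp add: root_at_def)
qed

text \<open>
  If \<open>t\<close> precedes \<open>i\<close>, inserting \<open>t\<close> applies the reflection in the root at \<open>t\<close> to the root at \<open>i\<close>;
  this reflection preserves the line of its own root.  So the common part \<open>M\<close> of the traversed
  positions, which treats \<open>i\<close> and \<open>t\<close> symmetrically, detects collinearity.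
\<close>

lemma collinear_roots_iff:
  assumes "t \<in> positions Q" "i \<in> positions Q" "t \<notin> M" "i \<notin> M"
  shows "root_at Q (insert t M) i \<in> {root_at Q (insert t M) t, - root_at Q (insert t M) t}
    \<longleftrightarrow> root_at Q M i \<in> {root_at Q M t, - root_at Q M t}"
  using refl_collinear_iff[of "root_at Q M t" "root_at Q M i"] root_at_insert[OF assms(1,3), of i]
  by auto

text \<open>
  Both elements differ from that of \<open>M\<close> by a reflection on the left.  Passing back from the action
  to the group uses faithfulness.
\<close>

lemma exchange_iff:
  assumes "t \<in> positions Q" "i \<in> positions Q" "t \<notin> M" "i \<notin> M"
  shows "wp (subword Q (insert i M)) = wp (subword Q (insert t M)) \<longleftrightarrow>
    root_at Q M i \<in> {root_at Q M t, - root_at Q M t}"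
proof
  assume "wp (subword Q (insert i M)) = wp (subword Q (insert t M))"
  then have "act (subword Q (insert i M)) = act (subword Q (insert t M))" by (rule act_eqI)
  then have *: "refl (root_at Q M i) (act (subword Q M) v) = refl (root_at Q M t) (act (subword Q M) v)"
    for v
    using act_subword_insert assms by metis
  have "act u (act (rev u) v) = v" for u v
    using act_rev_act[of "rev u" v] by simp
  then have "refl (root_at Q M i) = refl (root_at Q M t)"
    using *[of "act (rev (subword Q M)) _"] by (intro ext) simp
  then show "root_at Q M i \<in> {root_at Q M t, - root_at Q M t}"
    by (intro refl_eq_imp_collinear) auto
next
  assume "root_at Q M i \<in> {root_at Q M t, - root_at Q M t}"
  then have "refl (root_at Q M i) = refl (root_at Q M t)" by (rule refl_collinear_cong)
  then have "act (subword Q (insert i M)) = act (subword Q (insert t M))"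
    using assms by (simp add: fun_eq_iff act_subword_insert)
  then show "wp (subword Q (insert i M)) = wp (subword Q (insert t M))" by (rule act_faithful)
qed

text \<open>
  Both roots arise from the root of \<open>M\<close> at \<open>l\<close> by applying, or not, one and the same reflection.
\<close>

lemma root_at_exchange:
  assumes "t \<in> positions Q" "i \<in> positions Q" "t \<notin> M" "i \<notin> M"
    and "root_at Q M i \<in> {root_at Q M t, - root_at Q M t}"
  shows "root_at Q (insert t M) l - root_at Q (insert i M) l \<in> span {root_at Q M t}"
proof -
  have *: "refl \<gamma> v - v \<in> span {\<gamma>}" "v - refl \<gamma> v \<in> span {\<gamma>}"
    for \<gamma> v :: "real ^ 'n"
    by (auto simp: refl_def span_neg span_mul span_base)
  show ?thesis
    using assms(1-4) refl_collinear_cong[OF assms(5)] *[where \<gamma> = "root_at Q M t"]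
    by (simp add: root_at_insert span_zero)
qed

text \<open>
  If two traversed positions had collinear roots, the two reflections by which they contribute
  would cancel, and both letters could be deleted.
\<close>

lemma reduced_roots_not_collinear:
  assumes t: "t \<in> positions Q" "t' \<in> positions Q" "t \<in> K" "t' \<in> K" "t \<noteq> t'"
    and red: "reduced (subword Q K)"
  shows "root_at Q K t \<notin> {root_at Q K t', - root_at Q K t'}"
proof -
  have less: "root_at Q K a \<notin> {root_at Q K b, - root_at Q K b}"
    if ab: "a \<in> positions Q" "b \<in> positions Q" "a \<in> K" "b \<in> K" "a < b" for a b
  proof
    assume col: "root_at Q K a \<in> {root_at Q K b, - root_at Q K b}"
    define M where "M = K - {a, b}"
    have K: "K = insert b (insert a M)" and a: "a \<notin> M" and b: "b \<notin> insert a M"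
      using ab by (auto simp: M_def)
    have "root_at Q K a = root_at Q M a"
      using root_at_insert[OF ab(2) b, of a] ab(5) by (simp add: K)
    moreover have "root_at Q K b = root_at Q (insert a M) b"
      by (simp add: K)
    ultimately have refl: "refl (root_at Q M a) = refl (root_at Q (insert a M) b)"
      using col by (intro refl_collinear_cong) simp
    have "act (subword Q K) v = act (subword Q M) v" for v
      unfolding K act_subword_insert[OF ab(2) b] act_subword_insert[OF ab(1) a] refl
      by (simp add: refl_refl)
    then have "wp (subword Q M) = wp (subword Q K)" by (intro act_faithful) auto
    then have "length (subword Q K) \<le> length (subword Q M)" by (rule reduced_le[OF red])
    moreover have "positions Q \<inter> M \<subset> positions Q \<inter> K" using ab by (auto simp: M_def)
    then have "length (subword Q M) < length (subword Q K)"
      unfolding length_subword by (intro psubset_card_mono) (auto simp: positions_def)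
    ultimately show False by simp
  qed
  show ?thesis
    using less[of t t'] less[of t' t] t by (cases t t' rule: linorder_cases) auto
qed

lemma positive_root_exists:
  "\<exists>\<delta> \<in> positive_roots G s. \<delta> \<in> {act u (simple_root i), - act u (simple_root i)}"
proof -
  have root: "act v (simple_root i) \<in> roots G s" for v
    unfolding roots_def geom_act_word_prod[OF system, symmetric] using wp_closed[of v] by blast
  have neg: "- act u (simple_root i) \<in> roots G s"
    using root[of "u @ [i]"] by (simp only: act_snoc_simple_root)
  from root_sign[of u i] show ?thesis
  proof
    assume "\<forall>k. 0 \<le> act u (simple_root i) $ k"
    then show ?thesis using root[of u] by (auto simp: positive_roots_def)
  next
    assume "\<forall>k. act u (simple_root i) $ k \<le> 0"
    then show ?thesis using neg by (auto simp: positive_roots_def)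
  qed
qed

end


section \<open>Flips of a quadruple\<close>

locale coxeter_quadruple =
  fixes X :: "('g, 'n::finite) quadruple"
  assumes quadruple: "is_quadruple X"
begin

sublocale coxeter "cox_group X" "simple_refl X"
  using quadruple by unfold_locales (simp add: is_quadruple_def)

abbreviation Q :: "'n list" where "Q \<equiv> cox_word X"
abbreviation I :: "nat set" where "I \<equiv> facet X"

lemma facet_subset: "I \<subseteq> positions Q"
  and facet_reduced: "reduced_expression (cox_group X) (simple_refl X) (subword Q (- I)) (cox_elem X)"
  using quadruple by (auto simp: is_quadruple_def X_complex_def maximal_face_iff)

lemma maximal_face_X_iff:
  "maximal_face (X_complex X) J \<longleftrightarrow> J \<subseteq> positions Q \<and>
     reduced_expression (cox_group X) (simple_refl X) (subword Q (- J)) (cox_elem X)"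
  by (simp add: X_complex_def maximal_face_iff)

lemma root_fun_facet: "root_fun (X\<lparr>facet := J\<rparr>) l = root_at Q (- J) l"
proof -
  have "subword Q ({1..l - 1} - J) = subword Q (- J \<inter> {..<l})"
    by (rule subword_cong) (auto simp: positions_def)
  then show ?thesis
    by (simp add: root_fun_def root_at_def geom_act_word_prod[OF system])
qed

lemma root_fun_eq: "root_fun X l = root_at Q (- I) l"
  using root_fun_facet[of I] by simp

lemma traversing_unique:
  assumes "t \<in> positions Q - I" "t' \<in> positions Q - I"
    and "root_fun X t \<in> {root_fun X t', - root_fun X t'}"
  shows "t = t'"
proof (rule ccontr)
  assume "t \<noteq> t'"
  moreover have "reduced (subword Q (- I))"
    using facet_reduced by (auto simp: reduced_expression_def)
  ultimately show False
    using reduced_roots_not_collinear[of t Q t' "- I"] assms by (simp add: root_fun_eq)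
qed

text \<open>
  The exchanged set has the right size, so its complement is a reduced expression as soon as it
  represents the right element.
\<close>

lemma one_flip_iff:
  assumes "i \<in> I" "t \<in> positions Q - I"
  shows "maximal_face (X_complex X) ((I - {i}) \<union> {t}) \<longleftrightarrow>
    root_fun X i \<in> {root_fun X t, - root_fun X t}"
proof -
  define M where "M = - I - {t}"
  have it: "t \<in> positions Q" "i \<in> positions Q" "t \<notin> M" "i \<notin> M"
    using assms facet_subset by (auto simp: M_def)
  have M: "- I = insert t M" "- ((I - {i}) \<union> {t}) = insert i M"
    using assms by (auto simp: M_def)
  have sub: "(I - {i}) \<union> {t} \<subseteq> positions Q" using assms facet_subset by auto
  have "card ((I - {i}) \<union> {t}) = card I"
    using assms finite_subset[OF facet_subset] card_Suc_Diff1[of I i]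
    by (simp add: positions_def)
  then have len: "length (subword Q (insert i M)) = length (subword Q (insert t M))"
    using card_facet[OF sub] card_facet[OF facet_subset] M by simp
  have "maximal_face (X_complex X) ((I - {i}) \<union> {t}) \<longleftrightarrow>
      wp (subword Q (insert i M)) = wp (subword Q (insert t M))"
    using facet_reduced sub len unfolding maximal_face_X_iff M reduced_expression_def by auto
  also have "\<dots> \<longleftrightarrow> root_fun X i \<in> {root_fun X t, - root_fun X t}"
    unfolding root_fun_eq M exchange_iff[OF it] collinear_roots_iff[OF it] ..
  finally show ?thesis .
qed

text \<open>
  Up to sign, the common root \<open>\<gamma>\<close> of the exchanged positions is the new root at \<open>t\<close>, and the old
  roots differ from the new ones by multiples of \<open>\<gamma>\<close>.
\<close>

lemma flip_root_span:
  assumes "i \<in> I" "t \<in> positions Q - I" "root_fun X i \<in> {root_fun X t, - root_fun X t}"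
    and J: "J = (I - {i}) \<union> {t}"
  shows "root_span X I \<subseteq> root_span (X\<lparr>facet := J\<rparr>) J"
proof -
  define M where "M = - I - {t}"
  have it: "t \<in> positions Q" "i \<in> positions Q" "t \<notin> M" "i \<notin> M"
    using assms facet_subset by (auto simp: M_def)
  have M: "- I = insert t M" "- J = insert i M"
    using assms by (auto simp: M_def)
  define \<gamma> where "\<gamma> = root_at Q M t"
  let ?S = "span (root_at Q (insert i M) ` J)"
  have col: "root_at Q M i \<in> {\<gamma>, - \<gamma>}"
    using assms(3) unfolding root_fun_eq M collinear_roots_iff[OF it] \<gamma>_def .
  have "root_at Q (insert i M) t \<in> {\<gamma>, - \<gamma>}"
    using refl_collinear_cong[OF col] refl_self[of \<gamma>]
    by (simp add: root_at_insert[OF it(2,4)] \<gamma>_def)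
  moreover have "root_at Q (insert i M) t \<in> ?S" using J by (intro span_base) auto
  ultimately have \<gamma>: "\<gamma> \<in> ?S" by (metis insertE minus_minus singletonD span_neg)
  then have \<gamma>_span: "span {\<gamma>} \<subseteq> ?S" by (intro span_minimal) auto
  have "root_at Q (insert t M) l \<in> ?S" if "l \<in> I" for l
  proof (cases "l = i")
    case True
    have "root_at Q (insert t M) i \<in> {\<gamma>, - \<gamma>}"
      using assms(3) unfolding root_fun_eq M \<gamma>_def by simp
    then show ?thesis using \<gamma> True by (auto intro: span_neg)
  next
    case False
    then have "root_at Q (insert i M) l \<in> ?S" using that J by (intro span_base) auto
    moreover have "root_at Q (insert t M) l - root_at Q (insert i M) l \<in> ?S"
      using root_at_exchange[OF it col[unfolded \<gamma>_def], of l] \<gamma>_span by (auto simp: \<gamma>_def)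
    ultimately show ?thesis using span_add by fastforce
  qed
  then have "span (root_at Q (insert t M) ` I) \<subseteq> ?S" by (intro span_minimal) auto
  then show ?thesis by (simp add: root_span_def root_fun_facet root_fun_eq[abs_def] M)
qed

lemma form_root_fun: "form (root_fun X l) (root_fun X l) = 1"
  by (simp add: root_fun_eq)

text \<open>
  The roots of a rank one flat are unit vectors on the line of its simple root.
\<close>

lemma flippable_collinear:
  assumes "flippable X F" "a \<in> F" "b \<in> F"
  shows "root_fun X a \<in> {root_fun X b, - root_fun X b}"
proof -
  obtain \<delta> where \<delta>: "span {\<delta>} = root_span X F"
    using assms(1) unfolding flippable_def flat_degree_def flat_simple_roots_def Let_def
    by (metis card_1_singletonE)
  have "root_fun X l \<in> span {\<delta>}" if "l \<in> F" for l
    unfolding \<delta> root_span_def using that by (intro span_base) auto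
  then obtain c d where cd: "root_fun X a = c *\<^sub>R \<delta>" "root_fun X b = d *\<^sub>R \<delta>"
    using assms(2,3) by (metis span_breakdown_eq span_empty singletonD eq_iff_diff_eq_0)
  have "d \<noteq> 0"
    using form_root_fun[of b] cd(2) cox_form_scale_right[of "cox_group X" "simple_refl X" _ 0] by auto
  then have "root_fun X a = (c / d) *\<^sub>R root_fun X b" by (simp add: cd)
  then show ?thesis by (rule unit_collinear[OF form_root_fun form_root_fun])
qed

lemma traversing_pos_eq:
  assumes "flippable X F" "t \<in> F \<inter> (positions Q - I)"
  shows "traversing_pos X F = t"
  unfolding traversing_pos_def
proof (rule the_equality)
  show "t \<in> F \<inter> (X_positions X - facet X)" using assms(2) by (simp add: X_positions_def)
  fix t' assume "t' \<in> F \<inter> (X_positions X - facet X)"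
  then show "t' = t"
    using assms(2) flippable_collinear[OF assms(1), of t' t]
    by (intro traversing_unique) (auto simp: X_positions_def)
qed

text \<open>
  The flat of a line is spanned by any of its roots, so a folded position on the line makes it
  irreducible.  Its simple root is the positive one of the two roots on the line.
\<close>

lemma root_line_flippable:
  assumes "i \<in> I" "t \<in> positions Q - I" "root_fun X i \<in> {root_fun X t, - root_fun X t}"
  defines "F \<equiv> flat_of X (span {root_fun X t})"
  shows "flippable X F" "t \<in> F" "i \<in> F"
proof -
  let ?\<beta> = "root_fun X t"
  have "?\<beta> \<in> span {- ?\<beta>}" "- ?\<beta> \<in> span {?\<beta>}"
    using span_neg[OF span_base[of "- ?\<beta>" "{- ?\<beta>}"]] by (auto intro: span_neg span_base)
  then have neg: "span {- ?\<beta>} = span {?\<beta>}"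
    by (intro antisym span_minimal) auto
  show tF: "t \<in> F" using assms by (auto simp: flat_of_def X_positions_def span_base)
  show iF: "i \<in> F"
    using assms facet_subset by (auto simp: flat_of_def X_positions_def span_base span_neg)
  have F: "root_span X F = span {?\<beta>}"
  proof
    show "root_span X F \<subseteq> span {?\<beta>}"
      unfolding root_span_def by (intro span_minimal) (auto simp: F_def flat_of_def)
    show "span {?\<beta>} \<subseteq> root_span X F"
      unfolding root_span_def using tF by (intro span_mono) auto
  qed
  have "span {root_fun X i} \<subseteq> root_span X (F \<inter> I)"
    unfolding root_span_def using iF assms(1) by (intro span_mono) auto
  then have "root_span X F \<subseteq> root_span X (F \<inter> I)"
    using assms(3) neg by (auto simp: F)
  moreover have "root_span X (F \<inter> I) \<subseteq> root_span X F"
    unfolding root_span_def by (intro span_mono) auto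
  ultimately have "irreducible_flat X F"
    unfolding irreducible_flat_def is_flat_def F_def using subspace_span by blast
  moreover have "flat_degree X F 1"
  proof -
    obtain \<delta> where pos: "\<delta> \<in> positive_roots (cox_group X) (simple_refl X)" and \<delta>: "\<delta> \<in> {?\<beta>, - ?\<beta>}"
      using positive_root_exists unfolding root_fun_eq root_at_def by blast
    then have span: "span {\<delta>} = root_span X F"
      using neg by (auto simp: F)
    have "?\<beta> \<noteq> 0" using form_root_fun[of t] by (auto simp: cox_form_def)
    then have "\<delta> \<noteq> 0" using \<delta> by auto
    have "\<exists>c. 0 \<le> c \<delta> \<and> \<beta> = c \<delta> *\<^sub>R \<delta>"
      if \<beta>: "\<beta> \<in> positive_roots (cox_group X) (simple_refl X)" "\<beta> \<in> span {\<delta>}" for \<beta>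
    proof -
      obtain c where c: "\<beta> = c *\<^sub>R \<delta>"
        using \<beta>(2) by (metis span_breakdown_eq span_empty singletonD eq_iff_diff_eq_0)
      obtain k where "\<delta> $ k \<noteq> 0" using \<open>\<delta> \<noteq> 0\<close> by (auto simp: vec_eq_iff)
      then have "0 < \<delta> $ k" using pos by (auto simp: positive_roots_def less_le)
      moreover have "0 \<le> c * \<delta> $ k" using \<beta>(1) c by (auto simp: positive_roots_def)
      ultimately have "0 \<le> c" by (simp add: zero_le_mult_iff)
      with c show ?thesis by (intro exI[of _ "\<lambda>_. c"]) auto
    qed
    then have "flat_simple_roots X F {\<delta>}"
      unfolding flat_simple_roots_def Let_def span[symmetric]
      using pos \<open>\<delta> \<noteq> 0\<close> span_base[of \<delta> "{\<delta>}"] by simp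
    then show ?thesis unfolding flat_degree_def by (intro exI[of _ "{\<delta>}"]) auto
  qed
  ultimately show "flippable X F"
    using tF assms(2) by (auto simp: flippable_def X_positions_def)
qed

text \<open>
  All facets have the same size, so the removed singleton is replaced by a singleton.
\<close>

lemma one_flip_shape:
  assumes "is_1_flip (X_complex X) I L L' I'"
  obtains i t where "i \<in> I" "t \<in> positions Q - I" "L = {i}" "L' = {t}" "I' = (I - {i}) \<union> {t}"
proof -
  obtain i where L: "L = {i}" "i \<in> I"
    using assms by (auto simp: is_1_flip_def is_flip_def card_1_singleton_iff)
  have flip: "maximal_face (X_complex X) I'" "I' \<noteq> I" "L' \<subseteq> I'" "I - {i} = I' - L'"
    using assms by (auto simp: is_1_flip_def is_flip_def L)
  have I': "I' \<subseteq> positions Q"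
    "reduced_expression (cox_group X) (simple_refl X) (subword Q (- I')) (cox_elem X)"
    using flip(1) by (auto simp: maximal_face_X_iff)
  have fin: "finite I" "finite I'"
    using finite_subset[OF facet_subset] finite_subset[OF I'(1)] by (auto simp: positions_def)
  have "card I' = card I"
    using card_facet[OF I'(1)] card_facet[OF facet_subset]
      reduced_expression_length[OF I'(2) facet_reduced] by simp
  moreover have "card (I' - L') = card I' - card L'" "card L' \<le> card I'"
    using flip(3) fin by (auto intro: card_Diff_subset finite_subset card_mono)
  moreover have "card (I - {i}) = card I - 1" "card I \<noteq> 0" using L fin by auto
  ultimately have "card L' = 1" using flip(4) by simp
  then obtain t where t: "L' = {t}" by (auto simp: card_1_singleton_iff)
  have "I' = (I - {i}) \<union> {t}" using flip(3,4) t by auto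
  moreover have "t \<notin> I" using flip(2-4) L t by auto
  moreover have "t \<in> positions Q" using I'(1) flip(3) t by auto
  ultimately show ?thesis using that L t by blast
qed

end

theorem proposition1p28:
  fixes X :: "('g, 'n::finite) quadruple"
  assumes "irreducible_quadruple X"
  shows "(\<forall>F i. flippable X F \<and> i \<in> facet X \<inter> F \<longrightarrow>
            is_1_flip (X_complex X) (facet X) {i} {traversing_pos X F} (flip_facet X F i) \<and>
            irreducible_quadruple (flip_quadruple X F i)) \<and>
         (\<forall>L L' I'. is_1_flip (X_complex X) (facet X) L L' I' \<longrightarrow>
            (\<exists>F i. flippable X F \<and> i \<in> facet X \<inter> F \<and>
               L = {i} \<and> L' = {traversing_pos X F} \<and> I' = flip_facet X F i))"
proof (intro conjI allI impI)
  have quad: "is_quadruple X" and full: "root_span X (facet X) = UNIV"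
    using assms by (auto simp: irreducible_quadruple_def)
  interpret coxeter_quadruple X using quad by unfold_locales
  {
    fix F i
    assume Fi: "flippable X F \<and> i \<in> facet X \<inter> F"
    then obtain t where t: "t \<in> F" "t \<in> positions Q - I"
      by (auto simp: flippable_def X_positions_def)
    have tF: "traversing_pos X F = t" using Fi t by (intro traversing_pos_eq) auto
    have col: "root_fun X i \<in> {root_fun X t, - root_fun X t}"
      using Fi t(1) by (intro flippable_collinear[of F]) auto
    define J where "J = flip_facet X F i"
    have J: "J = (I - {i}) \<union> {t}" by (simp add: J_def flip_facet_def tF)
    have max: "maximal_face (X_complex X) J"
      unfolding J using Fi t(2) col by (subst one_flip_iff) auto
    then show "is_1_flip (X_complex X) I {i} {traversing_pos X F} (flip_facet X F i)"
      using Fi t(2) quad unfolding J_def[symmetric] tF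
      by (auto simp: is_1_flip_def is_flip_def is_quadruple_def J)
    have "root_span (X\<lparr>facet := J\<rparr>) J = UNIV"
      using flip_root_span[OF _ t(2) col J] Fi full by auto
    then show "irreducible_quadruple (flip_quadruple X F i)"
      using max quad
      by (simp add: irreducible_quadruple_def flip_quadruple_def J_def is_quadruple_def
          X_complex_def)
  }
  fix L L' I'
  assume flip: "is_1_flip (X_complex X) I L L' I'"
  then obtain i t where it: "i \<in> I" "t \<in> positions Q - I" "L = {i}" "L' = {t}"
    "I' = (I - {i}) \<union> {t}" by (rule one_flip_shape)
  have "maximal_face (X_complex X) I'" using flip by (simp add: is_1_flip_def is_flip_def)
  then have col: "root_fun X i \<in> {root_fun X t, - root_fun X t}"
    using one_flip_iff[OF it(1,2)] it(5) by simp
  define F where "F = flat_of X (span {root_fun X t})"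
  have F: "flippable X F" "t \<in> F" "i \<in> F"
    unfolding F_def by (rule root_line_flippable[OF it(1,2) col])+
  have "traversing_pos X F = t" using F it(2) by (intro traversing_pos_eq) auto
  then show "\<exists>F i. flippable X F \<and> i \<in> facet X \<inter> F \<and>
      L = {i} \<and> L' = {traversing_pos X F} \<and> I' = flip_facet X F i"
    using F it by (intro exI[of _ F] exI[of _ i]) (auto simp: flip_facet_def)
qed

end
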